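(* Let $n\ge2$ and let $S\in\mathcal{G}_n$ have right anti-diagonal $(e_1,\ldots,e_{n-1})$. Then $K_S=C_S$ if and only if $$e_i\le 1+\sum_{j=i+1}^{n-1}e_j\qquad\text{for every }1\le i\le n-2.$$
   Context: For a finite integer sequence $S=(s_1,\ldots,s_n)$, its difference triangle is defined by $s_a^0:=s_a$ and $s_a^b:=|s_{a+1}^{b-1}-s_a^{b-1}|$ for $b\ge 1$, $1\le a\le n-b$ (superscripts are row indices, not powers). $S$ is Gilbreath if $s_1^b=1$ for every $1\le b\le n-1$. For $n\ge 2$, $\mathcal{G}_n$ is the set of strictly increasing Gilbreath integer sequences $(s_1,\ldots,s_n)$ of length $n$ with $(s_1,s_2)=(2,3)$. The valid-extension set of $S$ is $K_S:=\{k\in\mathbb{Z}:(s_1,\ldots,s_n,k)\text{ is Gilbreath}\}$. The right anti-diagonal of $S$ is $(e_1,\ldots,e_{n-1})$ with $e_i:=s_{n-i}^i$, and $A(S):=\sum_{i=1}^{n-1}e_i$. The candidate set is $C_S:=\{k\in\mathbb{Z}:|k-s_n|\le A(S)+1,\ k\equiv s_n\pmod 2\}$. *)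

theory Defs
  imports "HOL-Number_Theory.Cong"
begin

text \<open>A sequence \<open>(s\<^sub>1, \<dots>, s\<^sub>n)\<close> is an integer list of length \<open>n\<close>. The column index \<open>a\<close> of the
  difference triangle starts at 1 and the row index \<open>b\<close> at 0; the entry is
  meaningful only for \<open>1 \<le> a\<close> and \<open>a + b \<le> length S\<close>.\<close>

fun diff_triangle :: "int list \<Rightarrow> nat \<Rightarrow> nat \<Rightarrow> int" where
  "diff_triangle S 0 a = S ! (a - 1)"
| "diff_triangle S (Suc b) a = \<bar>diff_triangle S b (a + 1) - diff_triangle S b a\<bar>"

definition gilbreath :: "int list \<Rightarrow> bool" where
  "gilbreath S \<longleftrightarrow> (\<forall>b\<in>{1..length S - 1}. diff_triangle S b 1 = 1)"

text \<open>Used only for \<open>n \<ge> 2\<close>.\<close>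

definition gilbreath_seqs :: "nat \<Rightarrow> int list set" where
  "gilbreath_seqs n =
     {S. length S = n \<and> sorted_wrt (<) S \<and> gilbreath S \<and> S ! 0 = 2 \<and> S ! 1 = 3}"

definition valid_extensions :: "int list \<Rightarrow> int set" where
  "valid_extensions S = {k. gilbreath (S @ [k])}"

definition right_antidiag :: "int list \<Rightarrow> nat \<Rightarrow> int" where
  "right_antidiag S i = diff_triangle S i (length S - i)"

definition antidiag_sum :: "int list \<Rightarrow> int" where
  "antidiag_sum S = (\<Sum>i = 1..length S - 1. right_antidiag S i)"

definition candidates :: "int list \<Rightarrow> int set" where
  "candidates S = {k. \<bar>k - last S\<bar> \<le> antidiag_sum S + 1 \<and> [k = last S] (mod 2)}"

end

theory Submission
  imports Defs
begin

text \<open>Appending \<open>k\<close> to \<open>S\<close> adds one anti-diagonal, obtained from \<open>\<bar>k - last S\<bar>\<close> by the successive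
  maps \<open>x \<mapsto> \<bar>x - e\<^sub>i\<bar>\<close>, and \<open>k\<close> is a valid extension iff the final value is 1. Modulo 2 the Gilbreath
  property forces \<open>e\<^sub>1, \<dots>, e\<^bsub>n-2\<^esub>\<close> to be even, while \<open>e\<^bsub>n-1\<^esub> = 1\<close>. Let \<open>V\<^sub>i\<close> be the set of
  \<open>x \<ge> 0\<close> that the maps from index \<open>i\<close> on send to 1, and \<open>C\<^sub>i\<close> the set of even \<open>x \<ge> 0\<close> with
  \<open>x \<le> 1 + e\<^sub>i + \<dots> + e\<^bsub>n-1\<^esub>\<close>. Always \<open>V\<^sub>i \<subseteq> C\<^sub>i\<close>, and by downward induction equality holds iff it
  holds at \<open>i + 1\<close> and \<open>0 \<in> V\<^sub>i\<close>, where the latter then says \<open>e\<^sub>i \<le> 1 + e\<^bsub>i+1\<^esub> + \<dots> + e\<^bsub>n-1\<^esub>\<close>.\<close>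

lemma foldl_absdiff_Cons:
  fixes e :: "nat \<Rightarrow> int"
  assumes "i \<le> m"
  shows "foldl (\<lambda>y j. \<bar>y - e j\<bar>) x [i..<Suc m] = foldl (\<lambda>y j. \<bar>y - e j\<bar>) \<bar>x - e i\<bar> [Suc i..<Suc m]"
  using assms by (simp add: upt_conv_Cons del: upt_Suc)

text \<open>Going backwards, \<open>x \<le> \<bar>x - e i\<bar> + e i\<close> raises the bound by
  \<open>e i\<close>, and an even \<open>e i\<close> preserves parity.\<close>

lemma foldl_absdiff_eq_1_imp:
  fixes e :: "nat \<Rightarrow> int"
  assumes "i \<le> m" "\<And>j. i \<le> j \<Longrightarrow> j < m \<Longrightarrow> even (e j)" "e m = 1"
    and "foldl (\<lambda>y j. \<bar>y - e j\<bar>) x [i..<Suc m] = 1"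
  shows "x \<le> 1 + sum e {i..m} \<and> even x"
  using assms
proof (induction i arbitrary: x rule: inc_induct)
  case base
  then show ?case by (auto simp: abs_if split: if_splits)
next
  case (step i)
  have "\<bar>x - e i\<bar> \<le> 1 + sum e {Suc i..m} \<and> even \<bar>x - e i\<bar>"
    using step by (intro step.IH) (auto simp: foldl_absdiff_Cons simp del: upt_Suc)
  moreover have "even (e i)" using step by auto
  moreover have "sum e {i..m} = e i + sum e {Suc i..m}"
    using step.hyps by (simp add: sum.atLeast_Suc_atMost)
  ultimately show ?case by auto
qed

lemma foldl_absdiff_preimage_eq_iff:
  fixes e :: "nat \<Rightarrow> int"
  assumes "i \<le> m" "\<And>j. i \<le> j \<Longrightarrow> j < m \<Longrightarrow> even (e j)" "\<And>j. i \<le> j \<Longrightarrow> j \<le> m \<Longrightarrow> 0 \<le> e j" "e m = 1"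
  shows "(\<forall>x\<ge>0. foldl (\<lambda>y j. \<bar>y - e j\<bar>) x [i..<Suc m] = 1 \<longleftrightarrow> x \<le> 1 + sum e {i..m} \<and> even x)
    \<longleftrightarrow> (\<forall>j\<in>{i..<m}. e j \<le> 1 + sum e {j + 1..m})"
  using assms
proof (induction i rule: inc_induct)
  case base
  \<comment> \<open>At \<open>i = m\<close> the right side is vacuous, so the two sets must agree
    outright: both are {0, 2}.\<close>
  have "\<bar>x - 1\<bar> = 1 \<longleftrightarrow> x \<le> 2 \<and> even x" if "0 \<le> x" for x :: int
    using that by presburger
  with base show ?case by auto
next
  case (step i)
  define V where "V i x \<longleftrightarrow> foldl (\<lambda>y j. \<bar>y - e j\<bar>) x [i..<Suc m] = 1" for i x
  define C where "C i x \<longleftrightarrow> x \<le> 1 + sum e {i..m} \<and> even x" for i x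
  have V: "V i x \<longleftrightarrow> V (Suc i) \<bar>x - e i\<bar>" for x
    using step.hyps by (simp add: V_def foldl_absdiff_Cons del: upt_Suc)
  have V_C: "C (Suc i) x" if "V (Suc i) x" for x
    using foldl_absdiff_eq_1_imp[of "Suc i" m e x] step that by (auto simp: V_def C_def)
  have sum_e: "sum e {i..m} = e i + sum e {Suc i..m}"
    using step.hyps by (simp add: sum.atLeast_Suc_atMost)
  have ei: "even (e i)" "0 \<le> e i" using step by auto
  have sum_ge: "0 \<le> sum e {Suc i..m}" using step by (intro sum_nonneg) auto
  have IH: "(\<forall>x\<ge>0. V (Suc i) x \<longleftrightarrow> C (Suc i) x) \<longleftrightarrow> (\<forall>j\<in>{Suc i..<m}. e j \<le> 1 + sum e {j + 1..m})"
    unfolding V_def C_def using step by (intro step.IH) auto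
  have "(\<forall>x\<ge>0. V i x \<longleftrightarrow> C i x) \<longleftrightarrow>
    (\<forall>x\<ge>0. V (Suc i) x \<longleftrightarrow> C (Suc i) x) \<and> e i \<le> 1 + sum e {Suc i..m}" (is "?L \<longleftrightarrow> ?R")
  proof
    assume L: ?L
    \<comment> \<open>The point 0 is mapped to \<open>e i\<close>, so membership of 0 turns into the
      bound on \<open>e i\<close>.\<close>
    have "C i 0" using sum_e ei sum_ge by (auto simp: C_def)
    then have "C (Suc i) (e i)" using L V[of 0] V_C ei by auto
    moreover have "V (Suc i) x" if "0 \<le> x" "C (Suc i) x" for x
    proof -
      \<comment> \<open>\<open>x + e i\<close> is a preimage of \<open>x\<close>, and the bound in
        \<open>C\<close> grows by exactly \<open>e i\<close>.\<close>
      have "C i (x + e i)" using that ei sum_e by (auto simp: C_def)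
      then show ?thesis using L V[of "x + e i"] that ei by auto
    qed
    ultimately show ?R using V_C unfolding C_def by blast
  next
    assume R: ?R
    \<comment> \<open>Of the two inequalities behind the absolute value, the one bounding
      \<open>e i - x\<close> is automatic from \<open>R\<close> and
      \<open>0 \<le> x\<close>.\<close>
    have "C (Suc i) \<bar>x - e i\<bar> \<longleftrightarrow> C i x" if "0 \<le> x" for x
      using R that ei sum_e by (auto simp: C_def)
    then show ?L using R V by (metis abs_ge_zero)
  qed
  also have "\<dots> \<longleftrightarrow> (\<forall>j\<in>insert i {Suc i..<m}. e j \<le> 1 + sum e {j + 1..m})"
    using IH by auto
  also have "insert i {Suc i..<m} = {i..<m}" using step.hyps by auto
  finally show ?case unfolding V_def C_def .
qed

lemma diff_triangle_append:
  "1 \<le> a \<Longrightarrow> a + b \<le> length S \<Longrightarrow> diff_triangle (S @ T) b a = diff_triangle S b a"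
  by (induction b arbitrary: a) (auto simp: nth_append)

text \<open>Below row 0 the first column is all ones, which forces even entries in column 2;
  differences of even entries then carry evenness to the right.\<close>

lemma gilbreath_diff_triangle_even:
  assumes "gilbreath S" "Suc (Suc a) + Suc b \<le> length S"
  shows "even (diff_triangle S (Suc b) (Suc (Suc a)))"
  using assms(2)
proof (induction a arbitrary: b)
  case 0
  have "diff_triangle S (Suc b) 1 = 1" "diff_triangle S (Suc (Suc b)) 1 = 1"
    using assms(1) 0 by (auto simp: gilbreath_def simp del: diff_triangle.simps)
  then show ?case
    by (simp add: diff_triangle.simps(2)[of S "Suc b"] numeral_2_eq_2 del: diff_triangle.simps)
      presburger
next
  case (Suc a)
  have "even (diff_triangle S (Suc b) (Suc (Suc a)))"
    "even (diff_triangle S (Suc (Suc b)) (Suc (Suc a)))"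
    using Suc by (auto simp del: diff_triangle.simps)
  then show ?case
    by (simp add: diff_triangle.simps(2)[of S "Suc b"] del: diff_triangle.simps)
qed

text \<open>Column \<open>length S - b\<close> is the last one in row \<open>Suc b\<close> of the
  extended triangle; its left neighbour in that row is the old
  \<open>right_antidiag S (Suc b)\<close>.\<close>

lemma diff_triangle_snoc:
  assumes "S \<noteq> []" "b < length S"
  shows "diff_triangle (S @ [k]) (Suc b) (length S - b) =
    foldl (\<lambda>y j. \<bar>y - right_antidiag S j\<bar>) \<bar>k - last S\<bar> [1..<Suc b]"
  using assms(2)
proof (induction b)
  case 0
  then show ?case by (simp add: nth_append last_conv_nth)
next
  case (Suc b)
  then show ?case
    by (simp add: diff_triangle_append right_antidiag_def diff_triangle.simps(2)[of _ "Suc b"]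
        Suc_diff_Suc del: diff_triangle.simps)
qed

lemma gilbreath_snoc_iff:
  assumes "gilbreath S" "S \<noteq> []"
  shows "gilbreath (S @ [k]) \<longleftrightarrow>
    foldl (\<lambda>y j. \<bar>y - right_antidiag S j\<bar>) \<bar>k - last S\<bar> [1..<length S] = 1"
proof -
  obtain m where m: "length S = Suc m" using assms(2) by (cases S) auto
  have "{1..length (S @ [k]) - 1} = insert (Suc m) {1..m}" using m by auto
  moreover have "diff_triangle (S @ [k]) b 1 = 1" if "b \<in> {1..m}" for b
    using that assms(1) m by (auto simp: gilbreath_def diff_triangle_append)
  ultimately have "gilbreath (S @ [k]) \<longleftrightarrow> diff_triangle (S @ [k]) (Suc m) 1 = 1"
    unfolding gilbreath_def by simp
  then show ?thesis
    using diff_triangle_snoc[OF assms(2), of m k] m by (simp del: diff_triangle.simps upt_Suc)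
qed

theorem theorem20:
  fixes n :: nat and S :: "int list"
  assumes "n \<ge> 2" and "S \<in> gilbreath_seqs n"
  shows "valid_extensions S = candidates S \<longleftrightarrow>
    (\<forall>i\<in>{1..n - 2}. right_antidiag S i \<le> 1 + (\<Sum>j = i + 1..n - 1. right_antidiag S j))"
proof -
  define e where "e = right_antidiag S"
  obtain m where n: "n = Suc m" and m: "1 \<le> m" using assms(1) by (cases n) auto
  have S: "length S = Suc m" "gilbreath S" "S \<noteq> []"
    using assms by (auto simp: gilbreath_seqs_def n)
  have e_m: "e m = 1"
    using S m by (auto simp: e_def right_antidiag_def gilbreath_def)
  have e_even: "even (e j)" if "1 \<le> j" "j < m" for j
    \<comment> \<open>For \<open>j < m\<close> the entry \<open>e j\<close> lies in column
      \<open>m + 1 - j\<close>, which is at least 2.\<close>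
    using gilbreath_diff_triangle_even[OF S(2), of "m - j - 1" "j - 1"] that S
    by (simp add: e_def right_antidiag_def Suc_diff_Suc Suc_diff_le del: diff_triangle.simps)
  have e_ge: "0 \<le> e j" if "1 \<le> j" for j
    using that by (cases j) (auto simp: e_def right_antidiag_def)
  define V where "V x \<longleftrightarrow> foldl (\<lambda>y j. \<bar>y - e j\<bar>) x [1..<Suc m] = 1" for x
  define C where "C x \<longleftrightarrow> x \<le> 1 + sum e {1..m} \<and> even x" for x
  have "valid_extensions S = {k. V \<bar>k - last S\<bar>}"
    using S by (simp add: valid_extensions_def gilbreath_snoc_iff V_def e_def del: upt_Suc)
  moreover have "candidates S = {k. C \<bar>k - last S\<bar>}"
    using S by (auto simp: candidates_def antidiag_sum_def C_def e_def cong_iff_dvd_diff)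
  ultimately have "valid_extensions S = candidates S \<longleftrightarrow> (\<forall>k. V \<bar>k - last S\<bar> \<longleftrightarrow> C \<bar>k - last S\<bar>)"
    by auto
  also have "\<dots> \<longleftrightarrow> (\<forall>x\<ge>0. V x \<longleftrightarrow> C x)"
    \<comment> \<open>Every \<open>x \<ge> 0\<close> is attained, by
      \<open>k = x + last S\<close>.\<close>
    by (metis abs_ge_zero abs_of_nonneg add_diff_cancel_right')
  also have "\<dots> \<longleftrightarrow> (\<forall>j\<in>{1..<m}. e j \<le> 1 + sum e {j + 1..m})"
    unfolding V_def C_def
    by (rule foldl_absdiff_preimage_eq_iff) (use m e_m e_even e_ge in auto)
  also have "{1..<m} = {1..n - 2}" using n m by auto
  finally show ?thesis by (simp add: n e_def)
qed

end
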